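(* Let $\{(A_n,p_n)\}_{n\in\mathbb{N}}$ be a rare-events source with shadow distributions $P_n$ and limit distribution $P$, let $\phi_n$ be the Good-Turing estimator computed from $X_{n,1},\dots,X_{n,n}$, and let $\lambda$ be the Poisson $P$-mixture. Let $r>0$ be such that $n^r d_{\mathrm W}(P_n,P)\to0$ as $n\to\infty$. Then for any $\delta>0$, $$n^{\min\{r,\,1/2\}-\delta}\ \sup_{k}\ \bigl|F(k;\lambda)-F(k;\phi_n)\bigr|\to0\quad\text{almost surely as } n\to\infty,$$ where the supremum is over $k\in\mathbb{N}_0$.
   Context: Rare-events source: a sequence $\{(A_n,p_n)\}_{n\in\mathbb{N}}$, where $A_n$ is a finite alphabet and $p_n$ a probability mass function on $A_n$, such that, with $X_n\sim p_n$, $Z_n=n\,p_n(X_n)$ and $P_n$ the distribution of $Z_n$ (the shadow distribution): (i) there is an interval $C=[\check c,\hat c]$ with $0<\check c\le\hat c<\infty$ such that $\check c/n\le p_n(a)\le\hat c/n$ for all $n$ and all $a\in A_n$; (ii) there is a probability distribution $P$ with $P_n\Rightarrow P$ weakly (so $P$ is supported on $C$). Sampling: for each $n$, $X_{n,1},\dots,X_{n,n}$ are i.i.d. from $p_n$; all samples live on a common probability space. Good-Turing estimator: let $\varphi_{n,k}$ be the number of symbols of $A_n$ that appear exactly $k$ times in $X_{n,1},\dots,X_{n,n}$. Then $\phi_n=\{\phi_{n,k}\}_{k\in\mathbb{N}_0}$ with $\phi_{n,k}=\frac{(k+1)\varphi_{n,k+1}}{n}$; it is a (random) probability mass function on $\mathbb{N}_0$.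 Poisson $P$-mixture: $\lambda=\{\lambda_k\}_{k\in\mathbb{N}_0}$ with $\lambda_k=\int_C\frac{x^ke^{-x}}{k!}\,\mathrm{d}P(x)$. $F(\cdot;Q)$ denotes the cumulative distribution function of the probability measure $Q$ (on the real line or on the integers). The Wasserstein distance between probability measures on $[0,\infty)$ is $d_{\mathrm W}(Q_1,Q_2)=\int_0^\infty|F(x;Q_1)-F(x;Q_2)|\,\mathrm{d}x$. *)

theory Defs
  imports "HOL-Probability.Probability"
begin

definition shadow_distribution :: "(nat \<Rightarrow> 'a pmf) \<Rightarrow> nat \<Rightarrow> real measure" where
  "shadow_distribution p n = distr (measure_pmf (p n)) borel (\<lambda>a. real n * pmf (p n) a)"

text \<open>
  All alphabets live in one type \<open>'a\<close>; the sequence starts at \<open>n = 1\<close>, and nothing is required of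
  the entry with index \<open>0\<close>. The interval \<open>C\<close> is \<open>{lo..hi}\<close>.
\<close>

locale rare_events_source =
  fixes A :: "nat \<Rightarrow> 'a set" and p :: "nat \<Rightarrow> 'a pmf" and lo hi :: real and P :: "real measure"
  assumes finite_alphabet: "n \<ge> 1 \<Longrightarrow> finite (A n)"
    and pmf_on_alphabet: "n \<ge> 1 \<Longrightarrow> set_pmf (p n) \<subseteq> A n"
    and lo_pos: "0 < lo"
    and lo_le_hi: "lo \<le> hi"
    and pmf_lower: "n \<ge> 1 \<Longrightarrow> a \<in> A n \<Longrightarrow> lo / real n \<le> pmf (p n) a"
    and pmf_upper: "n \<ge> 1 \<Longrightarrow> a \<in> A n \<Longrightarrow> pmf (p n) a \<le> hi / real n"
    and limit_distribution: "real_distribution P"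
    and shadow_weak_conv: "weak_conv_m (shadow_distribution p) P"

text \<open>
  Row \<open>n\<close> of the triangular array \<open>X\<close> consists of \<open>X n 1, \<dots>, X n n\<close>. The joint law of different
  rows is arbitrary. The variables take values in the alphabet almost surely.
\<close>

locale rare_events_sampling = rare_events_source A p lo hi P + prob_space M
  for A :: "nat \<Rightarrow> 'a set" and p :: "nat \<Rightarrow> 'a pmf" and lo hi :: real and P :: "real measure"
    and M :: "'w measure" +
  fixes X :: "nat \<Rightarrow> nat \<Rightarrow> 'w \<Rightarrow> 'a"
  assumes row_indep: "n \<ge> 1 \<Longrightarrow> indep_vars (\<lambda>_. count_space UNIV) (X n) {1..n}"
    and row_distr: "n \<ge> 1 \<Longrightarrow> i \<in> {1..n} \<Longrightarrow>
      distr M (count_space UNIV) (X n i) = measure_pmf (p n)"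

definition occurrences :: "(nat \<Rightarrow> nat \<Rightarrow> 'w \<Rightarrow> 'a) \<Rightarrow> nat \<Rightarrow> 'w \<Rightarrow> 'a \<Rightarrow> nat" where
  "occurrences X n \<omega> a = card {i \<in> {1..n}. X n i \<omega> = a}"

definition symbols_with_count ::
    "(nat \<Rightarrow> 'a set) \<Rightarrow> (nat \<Rightarrow> nat \<Rightarrow> 'w \<Rightarrow> 'a) \<Rightarrow> nat \<Rightarrow> 'w \<Rightarrow> nat \<Rightarrow> nat" where
  "symbols_with_count A X n \<omega> k = card {a \<in> A n. occurrences X n \<omega> a = k}"

definition good_turing ::
    "(nat \<Rightarrow> 'a set) \<Rightarrow> (nat \<Rightarrow> nat \<Rightarrow> 'w \<Rightarrow> 'a) \<Rightarrow> nat \<Rightarrow> 'w \<Rightarrow> nat \<Rightarrow> real" where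
  "good_turing A X n \<omega> k = real (k + 1) * real (symbols_with_count A X n \<omega> (k + 1)) / real n"

definition poisson_mixture :: "real set \<Rightarrow> real measure \<Rightarrow> nat \<Rightarrow> real" where
  "poisson_mixture C P k = (LINT x:C|P. x ^ k * exp (- x) / fact k)"

text \<open>Cumulative distribution function of a probability mass function on the natural numbers.\<close>

definition mass_cdf :: "(nat \<Rightarrow> real) \<Rightarrow> nat \<Rightarrow> real" where
  "mass_cdf q k = (\<Sum>j\<le>k. q j)"

text \<open>
  The Bochner integral below is \<open>0\<close> for a non-integrable integrand. This does not occur for
  distributions with bounded support, such as shadow distributions and their weak limits in
  a rare-events source.
\<close>

definition wasserstein :: "real measure \<Rightarrow> real measure \<Rightarrow> real" where
  "wasserstein Q1 Q2 = (LINT x:{0..}|lborel. \<bar>cdf Q1 x - cdf Q2 x\<bar>)"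

end

theory Submission
  imports Defs "HOL-Real_Asymp.Real_Asymp"
begin

text \<open>
  Let \<open>G k\<close> be the distribution function of the Poisson law as a function of its mean. The expected
  value of \<open>F(k; \<phi>\<^sub>n)\<close> is the average of binomial distribution functions with \<open>n - 1\<close> trials and
  success probabilities \<open>p\<^sub>n(a) \<le> hi / n\<close>, hence within \<open>O(1/n)\<close> of \<open>\<integral>G k dP\<^sub>n\<close>. Since \<open>G k\<close> is
  1-Lipschitz, replacing \<open>P\<^sub>n\<close> by \<open>P\<close> costs at most the Wasserstein distance. Changing one sample
  changes \<open>F(k; \<phi>\<^sub>n)\<close> by \<open>O(k/n)\<close>, so by McDiarmid's inequality it deviates from its mean by
  more than \<open>n powr (\<delta>/2 - 1/2)\<close> for some \<open>k \<le> ln n\<close> only with summable probability. Both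
  distribution functions are monotone and bounded by 1, and the Poisson mixture has mass \<open>O(1/n)\<close>
  beyond \<open>ln n\<close>, which settles larger \<open>k\<close>.
\<close>

section \<open>Poisson and binomial distribution functions\<close>

definition poisson_density :: "nat \<Rightarrow> real \<Rightarrow> real" where
  "poisson_density k x = x ^ k * exp (- x) / fact k"

definition poisson_cdf :: "nat \<Rightarrow> real \<Rightarrow> real" where
  "poisson_cdf k x = (\<Sum>j\<le>k. poisson_density j x)"

lemma poisson_density_nonneg: "x \<ge> 0 \<Longrightarrow> poisson_density k x \<ge> 0"
  by (simp add: poisson_density_def)

lemma poisson_density_sums: "(\<lambda>k. poisson_density k x) sums 1"
proof -
  have "(\<lambda>k. exp (- x) * (x ^ k /\<^sub>R fact k)) sums (exp (- x) * exp x)"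
    by (intro sums_mult exp_converges)
  then show ?thesis
    by (simp add: poisson_density_def exp_minus field_simps)
qed

lemma poisson_cdf_nonneg: "x \<ge> 0 \<Longrightarrow> poisson_cdf k x \<ge> 0"
  by (simp add: poisson_cdf_def poisson_density_nonneg sum_nonneg)

lemma poisson_cdf_le_1:
  assumes "x \<ge> 0" shows "poisson_cdf k x \<le> 1"
  using sum_le_suminf[of "\<lambda>k. poisson_density k x" "{..k}"] poisson_density_sums[of x]
  by (auto simp: poisson_cdf_def sums_iff poisson_density_nonneg assms)

lemma poisson_density_le_cdf: "x \<ge> 0 \<Longrightarrow> poisson_density k x \<le> poisson_cdf k x"
  unfolding poisson_cdf_def by (rule member_le_sum) (auto simp: poisson_density_nonneg)

lemma poisson_density_le_1: "x \<ge> 0 \<Longrightarrow> poisson_density k x \<le> 1"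
  using poisson_density_le_cdf poisson_cdf_le_1 order_trans by blast

lemma poisson_cdf_mono: "x \<ge> 0 \<Longrightarrow> k \<le> l \<Longrightarrow> poisson_cdf k x \<le> poisson_cdf l x"
  unfolding poisson_cdf_def by (intro sum_mono2) (auto simp: poisson_density_nonneg)

text \<open>Chernoff's bound with tilting parameter 1: on \<open>j > k\<close> the weight
  \<open>exp (j - k)\<close> exceeds 1, and the tilted masses again have a known total. With
  \<open>k\<close> near \<open>ln n\<close> the tail is of order \<open>1 / n\<close>.\<close>

lemma poisson_cdf_ge:
  assumes "x \<ge> 0" shows "poisson_cdf k x \<ge> 1 - exp (- real k) * exp ((exp 1 - 1) * x)"
proof -
  let ?e = "\<lambda>j. exp (- real k) * exp ((exp 1 - 1) * x) * poisson_density j (exp 1 * x)"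
  \<comment> \<open>Weighting by \<open>exp j\<close> turns the Poisson law of mean \<open>x\<close>
    into the one of mean \<open>exp 1 * x\<close>, up to the moment generating factor.\<close>
  have tilt: "?e j = exp (real j - real k) * poisson_density j x" for j
  proof -
    have "exp 1 ^ j = exp (real j)"
      using exp_of_nat_mult[of j "1::real"] by simp
    then have "exp (- real k) * exp ((exp 1 - 1) * x) * (exp 1 ^ j * exp (- (exp 1 * x)))
        = exp (real j - real k) * exp (- x)"
      by (simp add: algebra_simps flip: exp_add)
    then show ?thesis
      by (simp add: poisson_density_def power_mult_distrib mult_ac)
  qed
  have s: "?e sums (exp (- real k) * exp ((exp 1 - 1) * x) * 1)"
    by (intro sums_mult poisson_density_sums)
  have tail: "(\<lambda>j. poisson_density (j + Suc k) x) sums (1 - (\<Sum>j<Suc k. poisson_density j x))"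
    using sums_split_initial_segment[OF poisson_density_sums] by blast
  have tail_tilt: "(\<lambda>j. ?e (j + Suc k)) sums
      (exp (- real k) * exp ((exp 1 - 1) * x) - (\<Sum>j<Suc k. ?e j))"
    using sums_split_initial_segment[OF s, of "Suc k"] by simp
  have "poisson_density (j + Suc k) x \<le> ?e (j + Suc k)" for j
    unfolding tilt using assms by (simp add: mult_le_cancel_right1 poisson_density_nonneg not_less)
  then have "1 - (\<Sum>j<Suc k. poisson_density j x) \<le>
      exp (- real k) * exp ((exp 1 - 1) * x) - (\<Sum>j<Suc k. ?e j)"
    by (intro sums_le[OF _ tail tail_tilt])
  moreover have "(\<Sum>j<Suc k. ?e j) \<ge> 0"
    unfolding tilt using assms by (intro sum_nonneg) (simp add: poisson_density_nonneg)
  ultimately show ?thesis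
    by (simp add: poisson_cdf_def lessThan_Suc_atMost)
qed

lemma DERIV_poisson_density_0: "(poisson_density 0 has_real_derivative - poisson_density 0 x) (at x)"
  unfolding poisson_density_def[abs_def] by (auto intro!: derivative_eq_intros)

lemma DERIV_poisson_density_Suc:
  "(poisson_density (Suc k) has_real_derivative
     poisson_density k x - poisson_density (Suc k) x) (at x)"
proof -
  have "((\<lambda>x. x ^ Suc k * exp (- x) / fact (Suc k)) has_real_derivative
      (real (Suc k) * x ^ k * exp (- x) - x ^ Suc k * exp (- x)) / fact (Suc k)) (at x)"
    by (auto intro!: derivative_eq_intros simp del: fact_Suc power_Suc)
  then show ?thesis
    by (simp add: poisson_density_def[abs_def] diff_divide_distrib del: of_nat_Suc)
qed

text \<open>The derivatives of the densities telescope, so only the last density survives. This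
  gives both the Lipschitz constant 1 and the kernel for integration by parts.\<close>

lemma DERIV_poisson_cdf: "(poisson_cdf k has_real_derivative - poisson_density k x) (at x)"
proof (induction k)
  case 0
  then show ?case
    using DERIV_poisson_density_0 by (simp add: poisson_cdf_def[abs_def])
next
  case (Suc k)
  have "poisson_cdf (Suc k) = (\<lambda>x. poisson_cdf k x + poisson_density (Suc k) x)"
    by (simp add: poisson_cdf_def[abs_def])
  then show ?case
    using DERIV_add[OF Suc DERIV_poisson_density_Suc[of k x]] by simp
qed

lemma continuous_on_poisson_density: "continuous_on S (poisson_density k)"
  unfolding poisson_density_def[abs_def] by (intro continuous_intros) auto

lemma continuous_on_poisson_cdf: "continuous_on S (poisson_cdf k)"
  unfolding poisson_cdf_def[abs_def] poisson_density_def by (intro continuous_intros) auto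

lemma measurable_poisson_density [measurable]: "poisson_density k \<in> borel_measurable borel"
  by (intro borel_measurable_continuous_onI continuous_on_poisson_density)

lemma measurable_poisson_cdf [measurable]: "poisson_cdf k \<in> borel_measurable borel"
  by (intro borel_measurable_continuous_onI continuous_on_poisson_cdf)

text \<open>Restricted to the convex set \<open>{0..}\<close>, since the Poisson densities are
  bounded by 1 only for nonnegative arguments.\<close>

lemma lipschitz_nonneg_reals:
  fixes f f' :: "real \<Rightarrow> real"
  assumes "\<And>x. x \<ge> 0 \<Longrightarrow> (f has_real_derivative f' x) (at x)"
    and "\<And>x. x \<ge> 0 \<Longrightarrow> \<bar>f' x\<bar> \<le> 1" and "x \<ge> 0" "y \<ge> 0"
  shows "\<bar>f x - f y\<bar> \<le> \<bar>x - y\<bar>"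
  using field_differentiable_bound[of "{0..}" f f' 1 x y] assms
  by (auto intro: has_field_derivative_at_within)

text \<open>The derivative is a difference of two numbers in the unit interval. This bounds the
  second derivative of \<open>poisson_cdf\<close> and hence the error of an Euler step.\<close>

lemma poisson_density_lipschitz:
  assumes "x \<ge> 0" "y \<ge> 0"
  shows "\<bar>poisson_density k x - poisson_density k y\<bar> \<le> \<bar>x - y\<bar>"
proof (cases k)
  case 0
  show ?thesis unfolding 0
    by (rule lipschitz_nonneg_reals[OF DERIV_poisson_density_0 _ assms])
       (simp add: poisson_density_nonneg poisson_density_le_1)
next
  case (Suc j)
  have "\<bar>poisson_density j x - poisson_density (Suc j) x\<bar> \<le> 1" if "x \<ge> 0" for x
    using that poisson_density_nonneg[of x j] poisson_density_nonneg[of x "Suc j"]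
      poisson_density_le_1[of x j] poisson_density_le_1[of x "Suc j"] by linarith
  then show ?thesis unfolding Suc
    by (intro lipschitz_nonneg_reals[OF DERIV_poisson_density_Suc _ assms]) auto
qed

lemma poisson_cdf_lipschitz:
  "x \<ge> 0 \<Longrightarrow> y \<ge> 0 \<Longrightarrow> \<bar>poisson_cdf k x - poisson_cdf k y\<bar> \<le> \<bar>x - y\<bar>"
  by (rule lipschitz_nonneg_reals[OF DERIV_poisson_cdf])
     (auto simp: poisson_density_nonneg poisson_density_le_1)

section \<open>Poisson approximation of the binomial distribution function\<close>

definition binomial_cdf :: "nat \<Rightarrow> real \<Rightarrow> nat \<Rightarrow> real" where
  "binomial_cdf n q k = (\<Sum>j\<le>k. Bernstein n j q)"

lemma Bernstein_Suc_0: "Bernstein (Suc n) 0 q = (1 - q) * Bernstein n 0 q"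
  by (simp add: Bernstein_def)

text \<open>\<open>Bernstein n j q\<close> is the binomial mass at \<open>j\<close>; this is
  Pascal's rule, that is, conditioning on one additional trial.\<close>

lemma Bernstein_Suc_Suc:
  "Bernstein (Suc n) (Suc j) q = (1 - q) * Bernstein n (Suc j) q + q * Bernstein n j q"
proof (cases "j < n")
  case True
  then have "n - j = Suc (n - Suc j)" by simp
  then show ?thesis by (simp add: Bernstein_def algebra_simps)
qed (auto simp: Bernstein_def binomial_eq_0 algebra_simps)

lemma binomial_cdf_Suc_Suc:
  "binomial_cdf (Suc n) q (Suc k) = (1 - q) * binomial_cdf n q (Suc k) + q * binomial_cdf n q k"
  unfolding binomial_cdf_def sum.atMost_Suc_shift Bernstein_Suc_0 Bernstein_Suc_Suc
  by (simp add: sum.distrib distrib_left flip: sum_distrib_left)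

text \<open>Local error of one Euler step: the mean value theorem replaces the increment by the
  density at an intermediate point, and that density differs from the one at \<open>x\<close> by at
  most \<open>q\<close>.\<close>

lemma poisson_cdf_step:
  assumes "x \<ge> 0" "q \<ge> 0"
  shows "\<bar>poisson_cdf k (x + q) - (poisson_cdf k x - q * poisson_density k x)\<bar> \<le> q\<^sup>2"
proof (cases "q = 0")
  case False
  then obtain z where z: "x < z" "z < x + q"
      "poisson_cdf k (x + q) - poisson_cdf k x = (x + q - x) * - poisson_density k z"
    using MVT2[of x "x + q" "poisson_cdf k" "\<lambda>x. - poisson_density k x"] DERIV_poisson_cdf assms
    by force
  have "poisson_cdf k (x + q) - (poisson_cdf k x - q * poisson_density k x)
      = q * (poisson_density k x - poisson_density k z)"
    using z(3) by (simp add: algebra_simps)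
  then have "\<bar>poisson_cdf k (x + q) - (poisson_cdf k x - q * poisson_density k x)\<bar>
      = q * \<bar>poisson_density k x - poisson_density k z\<bar>"
    using assms by (simp add: abs_mult)
  also have "\<dots> \<le> q * q"
    using poisson_density_lipschitz[of x z k] z assms by (intro mult_left_mono) auto
  finally show ?thesis by (simp add: power2_eq_square)
qed simp

text \<open>
  The binomial distribution function is the Euler scheme with step \<open>q\<close> for the differential
  equation \<open>G k' = - (G k - G (k - 1))\<close> satisfied by the Poisson distribution function.
\<close>

lemma binomial_cdf_poisson_cdf:
  assumes "0 \<le> q" "q \<le> 1"
  shows "\<bar>binomial_cdf n q k - poisson_cdf k (real n * q)\<bar> \<le> real n * q\<^sup>2"
proof (induction n arbitrary: k)
  case 0
  have "binomial_cdf 0 q k = 1"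
    by (induction k) (simp_all add: binomial_cdf_def Bernstein_def)
  moreover have "poisson_cdf k 0 = 1"
    by (induction k) (simp_all add: poisson_cdf_def poisson_density_def)
  ultimately show ?case by simp
next
  case (Suc n)
  let ?x = "real n * q"
  have step: "\<bar>poisson_cdf k (real (Suc n) * q) - (poisson_cdf k ?x - q * poisson_density k ?x)\<bar> \<le> q\<^sup>2"
    using poisson_cdf_step[of ?x q k] assms by (simp add: algebra_simps)
  \<comment> \<open>The step is a convex combination with weights \<open>1 - q\<close> and
    \<open>q\<close>, so the inherited error is not amplified; for \<open>k = 0\<close> the second
    term is absent. Local errors therefore only add up.\<close>
  have "\<bar>binomial_cdf (Suc n) q k - (poisson_cdf k ?x - q * poisson_density k ?x)\<bar> \<le> real n * q\<^sup>2"
  proof (cases k)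
    case 0
    have "\<bar>(1 - q) * (binomial_cdf n q 0 - poisson_cdf 0 ?x)\<bar> \<le> 1 * (real n * q\<^sup>2)"
      unfolding abs_mult using assms by (intro mult_mono Suc.IH) auto
    then show ?thesis
      by (simp add: 0 binomial_cdf_def poisson_cdf_def Bernstein_Suc_0 algebra_simps)
  next
    case (Suc j)
    let ?d = "\<lambda>k. binomial_cdf n q k - poisson_cdf k ?x"
    have "\<bar>(1 - q) * ?d (Suc j) + q * ?d j\<bar> \<le> (1 - q) * (real n * q\<^sup>2) + q * (real n * q\<^sup>2)"
      using assms by (intro order_trans[OF abs_triangle_ineq] add_mono)
         (auto simp: abs_mult intro!: mult_left_mono Suc.IH)
    moreover have density: "poisson_density (Suc j) ?x = poisson_cdf (Suc j) ?x - poisson_cdf j ?x"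
      by (simp add: poisson_cdf_def)
    ultimately show ?thesis
      unfolding Suc binomial_cdf_Suc_Suc density by (simp add: algebra_simps)
  qed
  with step have "\<bar>binomial_cdf (Suc n) q k - poisson_cdf k (real (Suc n) * q)\<bar> \<le> real n * q\<^sup>2 + q\<^sup>2"
    by linarith
  then show ?case by (simp add: algebra_simps)
qed

section \<open>McDiarmid's inequality\<close>

text \<open>Fubini's theorem for one split-off coordinate; boundedness of \<open>f\<close> supplies
  the integrability.\<close>

lemma expectation_Pi_pmf_insert:
  fixes f :: "('i \<Rightarrow> 'a) \<Rightarrow> real"
  assumes "finite I" "i \<notin> I" and bnd: "\<And>x. \<bar>f x\<bar> \<le> B"
  shows "measure_pmf.expectation (Pi_pmf (insert i I) d p) f =
    measure_pmf.expectation (p i) (\<lambda>y. measure_pmf.expectation (Pi_pmf I d p) (\<lambda>g. f (g(i := y))))"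
proof -
  have "measure_pmf.expectation (Pi_pmf (insert i I) d p) f
      = measure_pmf.expectation (bind_pmf (p i) (\<lambda>y. map_pmf (\<lambda>g. g(i := y)) (Pi_pmf I d p))) f"
    using assms by (simp add: Pi_pmf_insert' map_pmf_def)
  also have "\<dots> = measure_pmf.expectation (p i)
      (\<lambda>y. measure_pmf.expectation (map_pmf (\<lambda>g. g(i := y)) (Pi_pmf I d p)) f)"
    unfolding measure_pmf_bind
    by (rule integral_bind[where K = "count_space UNIV" and B = B and B' = 1])
       (auto simp: bnd measure_pmf.emeasure_space_1 measure_pmf_in_subprob_algebra)
  finally show ?thesis by simp
qed

lemma nn_integral_Pi_pmf_insert:
  assumes "finite I" "i \<notin> I"
  shows "(\<integral>\<^sup>+ x. f x \<partial>Pi_pmf (insert i I) d p) = (\<integral>\<^sup>+ y. \<integral>\<^sup>+ g. f (g(i := y)) \<partial>Pi_pmf I d p \<partial>p i)"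
  using assms by (simp add: Pi_pmf_insert nn_integral_pair_pmf' case_prod_unfold)

text \<open>
  Conditioning on one coordinate splits the deviation into the deviation of the conditional
  expectation, which Hoeffding's lemma controls, and a deviation over the remaining coordinates.
\<close>

lemma McDiarmid_nn_integral_exp:
  fixes f :: "('i \<Rightarrow> 'a) \<Rightarrow> real"
  assumes "finite I" and bnd: "\<And>x. \<bar>f x\<bar> \<le> B" and "l > 0"
    and diff: "\<And>i x y. i \<in> I \<Longrightarrow> \<bar>f (x(i := y)) - f x\<bar> \<le> c i"
  shows "(\<integral>\<^sup>+ x. exp (l * (f x - measure_pmf.expectation (Pi_pmf I d p) f)) \<partial>Pi_pmf I d p)
    \<le> ennreal (exp (l\<^sup>2 * (\<Sum>i\<in>I. (c i)\<^sup>2) / 8))"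
  using assms(1) bnd diff
proof (induction I arbitrary: f rule: finite_induct)
  case empty
  then show ?case by simp
next
  case (insert i I)
  let ?E = "\<lambda>f. measure_pmf.expectation (Pi_pmf I d p) f"
  \<comment> \<open>Conditional expectation of \<open>f\<close> given that coordinate
    \<open>i\<close> equals \<open>y\<close>.\<close>
  define h where "h y = ?E (\<lambda>g. f (g(i := y)))" for y
  have int: "integrable (Pi_pmf I d p) (\<lambda>g. f (g(i := y)))" for y
    using insert.prems(1) by (intro measure_pmf.integrable_const_bound[where B = B]) auto
  have h_diff: "h y - h z \<le> c i" for y z
  proof -
    have "h y - h z = ?E (\<lambda>g. f (g(i := y)) - f (g(i := z)))"
      unfolding h_def by (intro Bochner_Integration.integral_diff[symmetric] int)
    also have "\<dots> \<le> c i"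
    proof (intro measure_pmf.integral_le_const Bochner_Integration.integrable_diff int AE_pmfI)
      fix g show "f (g(i := y)) - f (g(i := z)) \<le> c i"
        using insert.prems(2)[OF insertI1, of "g(i := z)" y] unfolding fun_upd_upd by linarith
    qed
    finally show ?thesis .
  qed
  \<comment> \<open>With the infimum as left endpoint, the range of \<open>h\<close> lies in an
    interval of length \<open>c i\<close>. An interval centred at the mean could need length
    \<open>2 * c i\<close> and would spoil the constant in Hoeffding's lemma.\<close>
  define a where "a = (INF y. h y)"
  have "bdd_below (range h)"
    using h_diff[of undefined] by (intro bdd_belowI[where m = "h undefined - c i"]) (auto simp: algebra_simps)
  then have "a \<le> h y" for y
    unfolding a_def by (rule cINF_lower) simp
  moreover have "h y \<le> a + c i" for y
  proof -
    have "h y - c i \<le> a"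
      unfolding a_def by (rule cINF_greatest) (use h_diff in \<open>auto simp: algebra_simps\<close>)
    then show ?thesis by simp
  qed
  ultimately interpret h: interval_bounded_random_variable "p i" h a "a + c i"
    by unfold_locales auto
  let ?m = "measure_pmf.expectation (p i) h"
  have Eh: "measure_pmf.expectation (Pi_pmf (insert i I) d p) f = ?m"
    unfolding h_def[abs_def]
    using insert.hyps insert.prems(1) by (intro expectation_Pi_pmf_insert)
  have IH: "(\<integral>\<^sup>+ g. exp (l * (f (g(i := y)) - h y)) \<partial>Pi_pmf I d p)
      \<le> ennreal (exp (l\<^sup>2 * (\<Sum>i\<in>I. (c i)\<^sup>2) / 8))" for y
    unfolding h_def
  proof (rule insert.IH)
    fix j x z assume "j \<in> I"
    then have "j \<noteq> i" using insert.hyps by auto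
    then show "\<bar>f (x(j := z, i := y)) - f (x(i := y))\<bar> \<le> c j"
      using insert.prems(2)[OF insertI2, of j "x(i := y)" z] \<open>j \<in> I\<close>
      by (subst fun_upd_twist)
  qed (rule insert.prems(1))
  have "(\<integral>\<^sup>+ x. exp (l * (f x - ?m)) \<partial>Pi_pmf (insert i I) d p)
      = (\<integral>\<^sup>+ y. ennreal (exp (l * (h y - ?m))) *
          (\<integral>\<^sup>+ g. ennreal (exp (l * (f (g(i := y)) - h y))) \<partial>Pi_pmf I d p) \<partial>p i)"
    using insert.hyps
    by (simp add: nn_integral_Pi_pmf_insert algebra_simps flip: nn_integral_cmult ennreal_mult exp_add)
  also have "\<dots> \<le> (\<integral>\<^sup>+ y. ennreal (exp (l * (h y - ?m))) *
      ennreal (exp (l\<^sup>2 * (\<Sum>i\<in>I. (c i)\<^sup>2) / 8)) \<partial>p i)"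
    by (intro nn_integral_mono mult_left_mono IH) auto
  also have "\<dots> = (\<integral>\<^sup>+ y. exp (l * (h y - ?m)) \<partial>p i) *
      ennreal (exp (l\<^sup>2 * (\<Sum>i\<in>I. (c i)\<^sup>2) / 8))"
    by (rule nn_integral_multc) auto
  also have "\<dots> \<le> ennreal (exp (l\<^sup>2 * (a + c i - a)\<^sup>2 / 8)) *
      ennreal (exp (l\<^sup>2 * (\<Sum>i\<in>I. (c i)\<^sup>2) / 8))"
    by (intro mult_right_mono h.Hoeffdings_lemma_nn_integral \<open>l > 0\<close>) auto
  also have "\<dots> = ennreal (exp (l\<^sup>2 * (\<Sum>i\<in>insert i I. (c i)\<^sup>2) / 8))"
    using insert.hyps by (simp add: algebra_simps add_divide_distrib flip: ennreal_mult exp_add)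
  finally show ?case unfolding Eh .
qed

lemma McDiarmid_upper:
  fixes f :: "('i \<Rightarrow> 'a) \<Rightarrow> real"
  assumes "finite I" and "\<And>x. \<bar>f x\<bar> \<le> B" and "t \<ge> 0"
    and "\<And>i x y. i \<in> I \<Longrightarrow> \<bar>f (x(i := y)) - f x\<bar> \<le> c i"
    and pos: "(\<Sum>i\<in>I. (c i)\<^sup>2) > 0"
  shows "measure_pmf.prob (Pi_pmf I d p) {x. f x - measure_pmf.expectation (Pi_pmf I d p) f \<ge> t}
    \<le> exp (- 2 * t\<^sup>2 / (\<Sum>i\<in>I. (c i)\<^sup>2))"
proof (cases "t = 0")
  case False
  define S where "S = (\<Sum>i\<in>I. (c i)\<^sup>2)"
  \<comment> \<open>This value minimises the exponent \<open>- l * t + l\<^sup>2 * S / 8\<close>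
    left by Markov's inequality. For \<open>t = 0\<close> it would not be positive, but then the
    claimed bound is 1.\<close>
  define l where "l = 4 * t / S"
  define Q where "Q = Pi_pmf I d p"
  define g where "g x = f x - measure_pmf.expectation Q f" for x
  have l: "l > 0" using False assms by (simp add: l_def S_def)
  have "emeasure Q {x. g x \<ge> t} = emeasure Q ({x \<in> UNIV. 1 \<le> ennreal (exp (- l * t)) * ennreal (exp (l * g x))} \<inter> UNIV)"
    using l by (intro arg_cong2[where f = emeasure])
      (auto simp: simp flip: ennreal_mult exp_add)
  also have "\<dots> \<le> ennreal (exp (- l * t)) * (\<integral>\<^sup>+ x. ennreal (exp (l * g x)) * indicator UNIV x \<partial>Q)"
    using nn_integral_Markov_inequality[of "\<lambda>x. ennreal (exp (l * g x))" UNIV Q "ennreal (exp (- l * t))"]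
    by simp
  also have "\<dots> \<le> ennreal (exp (- l * t)) * ennreal (exp (l\<^sup>2 * S / 8))"
    using McDiarmid_nn_integral_exp[where f = f and c = c and d = d and p = p, OF assms(1,2) l assms(4)]
    by (intro mult_left_mono) (simp_all add: S_def g_def Q_def)
  also have "\<dots> = ennreal (exp (- 2 * t\<^sup>2 / S))"
    using pos by (simp add: l_def S_def[symmetric] power2_eq_square field_simps flip: ennreal_mult exp_add)
  finally show ?thesis
    by (simp add: S_def g_def Q_def measure_pmf.emeasure_eq_measure)
qed simp

lemma McDiarmid_inequality:
  fixes f :: "('i \<Rightarrow> 'a) \<Rightarrow> real"
  assumes "finite I" and bnd: "\<And>x. \<bar>f x\<bar> \<le> B" and "t \<ge> 0"
    and diff: "\<And>i x y. i \<in> I \<Longrightarrow> \<bar>f (x(i := y)) - f x\<bar> \<le> c i"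
    and pos: "(\<Sum>i\<in>I. (c i)\<^sup>2) > 0"
  shows "measure_pmf.prob (Pi_pmf I d p) {x. \<bar>f x - measure_pmf.expectation (Pi_pmf I d p) f\<bar> \<ge> t}
    \<le> 2 * exp (- 2 * t\<^sup>2 / (\<Sum>i\<in>I. (c i)\<^sup>2))"
proof -
  let ?Q = "Pi_pmf I d p"
  let ?U = "{x. f x - measure_pmf.expectation ?Q f \<ge> t}"
  let ?L = "{x. - f x - measure_pmf.expectation ?Q (\<lambda>x. - f x) \<ge> t}"
  have "measure_pmf.prob ?Q {x. \<bar>f x - measure_pmf.expectation ?Q f\<bar> \<ge> t}
      \<le> measure_pmf.prob ?Q (?U \<union> ?L)"
    by (intro measure_pmf.finite_measure_mono) auto
  also have "\<dots> \<le> measure_pmf.prob ?Q ?U + measure_pmf.prob ?Q ?L"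
    by (intro measure_Un_le) auto
  also have "measure_pmf.prob ?Q ?U \<le> exp (- 2 * t\<^sup>2 / (\<Sum>i\<in>I. (c i)\<^sup>2))"
    by (rule McDiarmid_upper[OF assms])
  also have "measure_pmf.prob ?Q ?L \<le> exp (- 2 * t\<^sup>2 / (\<Sum>i\<in>I. (c i)\<^sup>2))"
  proof (rule McDiarmid_upper[where B = B, OF assms(1) _ assms(3) _ pos])
    fix i x y assume "i \<in> I"
    then show "\<bar>- f (x(i := y)) - - f x\<bar> \<le> c i"
      using diff[of i x y] by simp
  qed (simp add: bnd)
  finally show ?thesis by simp
qed

section \<open>Wasserstein distance and weak limits\<close>

lemma (in real_distribution) measurable_cdf: "cdf M \<in> borel_measurable borel"
  by (intro borel_measurable_mono monoI cdf_nondecreasing)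

lemma cdf_below_support:
  assumes "real_distribution Q" "AE x in Q. x \<in> {lo..hi}" "t < lo"
  shows "cdf Q t = 0"
proof -
  interpret real_distribution Q by fact
  have "AE x in Q. x \<notin> {..t}" using assms(2) by eventually_elim (use assms(3) in auto)
  then show ?thesis
    by (subst (asm) prob_eq_0[symmetric]) (auto simp: cdf_def2)
qed

lemma cdf_above_support:
  assumes "real_distribution Q" "AE x in Q. x \<in> {lo..hi}" "t \<ge> hi"
  shows "cdf Q t = 1"
proof -
  interpret real_distribution Q by fact
  have "AE x in Q. x \<in> {..t}" using assms(2) by eventually_elim (use assms(3) in auto)
  then show ?thesis
    by (subst (asm) prob_eq_1[symmetric]) (auto simp: cdf_def2)
qed

text \<open>Write \<open>G x\<close> as \<open>G hi\<close> minus the integral of \<open>g\<close>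
  from \<open>x\<close> to \<open>hi\<close> and exchange the integrals: integrating the indicator
  of \<open>x \<le> t\<close> over \<open>Q\<close> yields \<open>cdf Q t\<close>.\<close>

lemma integral_by_parts_cdf:
  fixes G g :: "real \<Rightarrow> real"
  assumes "real_distribution Q" and supp: "AE x in Q. x \<in> {lo..hi}"
    and deriv: "\<And>x. x \<in> {lo..hi} \<Longrightarrow> (G has_real_derivative g x) (at x)"
    and cont: "continuous_on {lo..hi} g" and [measurable]: "G \<in> borel_measurable borel"
  shows "set_integrable lborel {lo..hi} (\<lambda>t. g t * cdf Q t)"
    and "integral\<^sup>L Q G = G hi - (LINT t:{lo..hi}|lborel. g t * cdf Q t)"
proof -
  interpret real_distribution Q by fact
  interpret pair_sigma_finite lborel Q
    by unfold_locales
  define gi where "gi t = indicator {lo..hi} t * g t" for t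
  have gi: "integrable lborel gi"
    using borel_integrable_atLeastAtMost'[OF cont] by (simp add: gi_def[abs_def] set_integrable_def)
  note [measurable] = borel_measurable_integrable[OF gi] measurable_cdf
  define f where "f = (\<lambda>(t, x). gi t * indicator {..t} x)"
  have f_meas [measurable]: "f \<in> borel_measurable (lborel \<Otimes>\<^sub>M Q)"
  proof -
    have "f = (\<lambda>z. gi (fst z) * (if snd z \<le> fst z then 1 else 0))"
      by (auto simp: f_def fun_eq_iff indicator_def)
    then show ?thesis by simp
  qed
  have inner: "(\<integral>x. f (t, x) \<partial>Q) = gi t * cdf Q t" for t
    by (simp add: f_def cdf_def2)
  have int_cdf: "integrable lborel (\<lambda>t. gi t * cdf Q t)"
    using gi by (rule Bochner_Integration.integrable_bound)
      (auto simp: abs_mult mult_left_le cdf_nonneg cdf_bounded_prob)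
  then show "set_integrable lborel {lo..hi} (\<lambda>t. g t * cdf Q t)"
    by (simp add: set_integrable_def gi_def mult_ac)
  have "integrable (lborel \<Otimes>\<^sub>M Q) f"
  proof (rule Fubini_integrable[OF f_meas])
    have "(\<lambda>t. \<integral>x. norm (f (t, x)) \<partial>Q) = (\<lambda>t. norm (gi t * cdf Q t))"
      by (simp add: f_def cdf_def2 abs_mult)
    then show "integrable lborel (\<lambda>t. \<integral>x. norm (f (t, x)) \<partial>Q)"
      using int_cdf by simp
  qed (auto simp: f_def emeasure_eq_measure)
  then have swap: "(\<integral>x. (\<integral>t. f (t, x) \<partial>lborel) \<partial>Q) = (\<integral>t. gi t * cdf Q t \<partial>lborel)"
    using Fubini_integral[of "\<lambda>t x. f (t, x)"] by (simp add: inner)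
  have tail: "G x = G hi - (\<integral>t. f (t, x) \<partial>lborel)" if "x \<in> {lo..hi}" for x
  proof -
    have "(LINT t:{x..hi}|lborel. g t) = G hi - G x"
      using that unfolding set_lebesgue_integral_def
      by (intro integral_FTC_atLeastAtMost)
        (auto intro!: continuous_on_subset[OF cont] has_field_derivative_at_within deriv
           simp flip: has_real_derivative_iff_has_vector_derivative)
    also have "(LINT t:{x..hi}|lborel. g t) = (\<integral>t. f (t, x) \<partial>lborel)"
      unfolding set_lebesgue_integral_def using that
      by (intro Bochner_Integration.integral_cong) (auto simp: f_def gi_def indicator_def)
    finally show ?thesis by simp
  qed
  have "AE x in Q. G x = G hi - (\<integral>t. f (t, x) \<partial>lborel)"
    using supp by eventually_elim (rule tail)
  then have "integral\<^sup>L Q G = (\<integral>x. G hi - (\<integral>t. f (t, x) \<partial>lborel) \<partial>Q)"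
    by (intro integral_cong_AE) auto
  also have "\<dots> = G hi - (\<integral>x. (\<integral>t. f (t, x) \<partial>lborel) \<partial>Q)"
    using integrable_snd[of "\<lambda>t x. f (t, x)"] \<open>integrable _ f\<close>
    by (subst Bochner_Integration.integral_diff) (auto simp: prob_space[simplified])
  finally show "integral\<^sup>L Q G = G hi - (LINT t:{lo..hi}|lborel. g t * cdf Q t)"
    by (simp add: swap gi_def set_lebesgue_integral_def mult_ac)
qed

lemma wasserstein_nonneg: "wasserstein Q1 Q2 \<ge> 0"
  unfolding wasserstein_def set_lebesgue_integral_def by (intro integral_nonneg_AE) auto

text \<open>The easy half of Kantorovich duality. The boundary terms \<open>G hi\<close> of the two
  integrations by parts cancel, and the kernel is bounded by 1.\<close>

lemma integral_diff_le_wasserstein: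
  fixes G g :: "real \<Rightarrow> real"
  assumes Q1: "real_distribution Q1" "AE x in Q1. x \<in> {lo..hi}"
    and Q2: "real_distribution Q2" "AE x in Q2. x \<in> {lo..hi}" and "lo \<ge> 0"
    and deriv: "\<And>x. x \<in> {lo..hi} \<Longrightarrow> (G has_real_derivative g x) (at x)"
    and cont: "continuous_on {lo..hi} g" and meas: "G \<in> borel_measurable borel"
    and bnd: "\<And>x. x \<in> {lo..hi} \<Longrightarrow> \<bar>g x\<bar> \<le> 1"
  shows "\<bar>integral\<^sup>L Q1 G - integral\<^sup>L Q2 G\<bar> \<le> wasserstein Q1 Q2"
proof -
  interpret Q1: real_distribution Q1 by fact
  interpret Q2: real_distribution Q2 by fact
  note parts1 = integral_by_parts_cdf[OF Q1 deriv cont meas]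
  note parts2 = integral_by_parts_cdf[OF Q2 deriv cont meas]
  note [measurable] = Q1.measurable_cdf Q2.measurable_cdf
  let ?D = "\<lambda>t. cdf Q1 t - cdf Q2 t"
  \<comment> \<open>This lets the integral over \<open>{lo..hi}\<close> be extended to the half-line
    used by \<open>wasserstein\<close>.\<close>
  have outside: "cdf Q1 t = cdf Q2 t" if "\<not> (lo \<le> t \<and> t \<le> hi)" for t
    using that cdf_below_support[OF Q1, of t] cdf_below_support[OF Q2, of t]
      cdf_above_support[OF Q1, of t] cdf_above_support[OF Q2, of t] by linarith
  \<comment> \<open>Integrability has to be secured first: a Bochner integral that defaulted to
    \<open>0\<close> could not serve as an upper bound.\<close>
  have "set_integrable lborel {lo..hi} (\<lambda>_. 1 :: real)"
    by (intro borel_integrable_atLeastAtMost' continuous_intros)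
  then have int: "set_integrable lborel {lo..hi} (\<lambda>t. \<bar>?D t\<bar>)"
    unfolding set_integrable_def
  proof (rule Bochner_Integration.integrable_bound, goal_cases)
    case 2
    have "\<bar>?D t\<bar> \<le> 1" for t
      using Q1.cdf_bounded_prob[of t] Q2.cdf_bounded_prob[of t] Q1.cdf_nonneg[of t] Q2.cdf_nonneg[of t]
      by linarith
    then show ?case by (auto simp: indicator_def)
  qed simp
  have "integral\<^sup>L Q2 G - integral\<^sup>L Q1 G = (LINT t:{lo..hi}|lborel. g t * cdf Q1 t - g t * cdf Q2 t)"
    using parts1 parts2 by (subst set_integral_diff) auto
  then have "\<bar>integral\<^sup>L Q1 G - integral\<^sup>L Q2 G\<bar> = norm (LINT t:{lo..hi}|lborel. g t * ?D t)"
    by (simp add: right_diff_distrib abs_minus_commute)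
  also have "\<dots> \<le> (LINT t:{lo..hi}|lborel. norm (g t * ?D t))"
    using set_integral_diff(1)[OF parts1(1) parts2(1)]
    by (intro set_integral_norm_bound) (simp add: right_diff_distrib)
  also have "\<dots> \<le> (LINT t:{lo..hi}|lborel. \<bar>?D t\<bar>)"
    using set_integrable_norm[OF set_integral_diff(1)[OF parts1(1) parts2(1)]] int bnd
    by (intro set_integral_mono) (auto simp: abs_mult mult_left_le_one_le right_diff_distrib[symmetric])
  also have "\<dots> = (LINT t:{0..}|lborel. \<bar>?D t\<bar>)"
    unfolding set_lebesgue_integral_def
  proof (intro Bochner_Integration.integral_cong refl)
    fix t show "indicat_real {lo..hi} t *\<^sub>R \<bar>?D t\<bar> = indicat_real {0..} t *\<^sub>R \<bar>?D t\<bar>"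
      using \<open>lo \<ge> 0\<close> outside[of t] by (cases "lo \<le> t \<and> t \<le> hi") auto
  qed
  finally show ?thesis by (simp add: wasserstein_def)
qed

lemma (in real_distribution) exists_isCont_cdf:
  assumes "a < b" obtains c where "a < c" "c < b" "isCont (cdf M) c"
proof -
  \<comment> \<open>The distribution function jumps exactly at the atoms, and these are
    countable.\<close>
  have "uncountable ({a<..<b} - {x. measure M {x} > 0})"
    using countable_atoms assms by (intro uncountable_minus_countable) (simp_all add: uncountable_open_interval)
  then obtain c where "c \<in> {a<..<b} - {x. measure M {x} > 0}"
    by (metis countable_empty equals0I)
  then show ?thesis
    using that[of c] measure_nonneg[of M "{c}"] by (auto simp: isCont_cdf not_less intro: antisym)
qed

text \<open>Convergence is available only at continuity points of \<open>cdf P\<close>. Such points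
  exist arbitrarily close to \<open>lo\<close> and \<open>hi\<close> outside the interval, and
  monotonicity carries the limiting values 0 and 1 to all outer points.\<close>

lemma weak_limit_support:
  assumes conv: "weak_conv_m Q P" and "real_distribution P"
    and Q: "\<forall>\<^sub>F n in sequentially. real_distribution (Q n) \<and> (AE x in Q n. x \<in> {lo..hi})"
  shows "AE x in P. x \<in> {lo..hi}"
proof -
  interpret real_distribution P by fact
  have lim: "(\<lambda>n. cdf (Q n) c) \<longlonglongrightarrow> cdf P c" if "isCont (cdf P) c" for c
    using conv that by (simp add: weak_conv_m_def weak_conv_def)
  have below: "cdf P x = 0" if less: "x < lo" for x
  proof -
    obtain c where c: "x < c" "c < lo" "isCont (cdf P) c"
      by (rule exists_isCont_cdf[OF less])
    have "\<forall>\<^sub>F n in sequentially. cdf (Q n) c = 0"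
      using Q by eventually_elim (use cdf_below_support c in blast)
    then have "cdf P c = 0"
      by (intro LIMSEQ_unique[OF lim[OF c(3)]] tendsto_eventually)
    then show ?thesis
      using cdf_nondecreasing[of x c] cdf_nonneg[of x] c by linarith
  qed
  have above: "cdf P x = 1" if less: "x > hi" for x
  proof -
    obtain c where c: "hi < c" "c < x" "isCont (cdf P) c"
      by (rule exists_isCont_cdf[OF less])
    have "\<forall>\<^sub>F n in sequentially. cdf (Q n) c = 1"
      using Q by eventually_elim (use cdf_above_support c in \<open>meson less_imp_le\<close>)
    then have "cdf P c = 1"
      by (intro LIMSEQ_unique[OF lim[OF c(3)]] tendsto_eventually)
    then show ?thesis
      using cdf_nondecreasing[of c x] cdf_bounded_prob[of x] c by linarith
  qed
  \<comment> \<open>\<open>P\<close> may have an atom at \<open>lo\<close>, so the left limit is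
    needed here; at \<open>hi\<close> right continuity suffices.\<close>
  have "((cdf P) \<longlongrightarrow> 0) (at_left lo)"
    by (rule tendsto_eventually) (auto simp: eventually_at_filter below)
  then have "prob {..<lo} = 0"
    by (intro tendsto_unique[OF trivial_limit_at_left_real cdf_at_left])
  then have "AE x in P. x \<notin> {..<lo}"
    by (subst prob_eq_0[symmetric]) auto
  moreover have "((cdf P) \<longlongrightarrow> 1) (at_right hi)"
    by (rule tendsto_eventually) (auto simp: eventually_at_filter above)
  then have "cdf P hi = 1"
    using cdf_is_right_cont[of hi]
    by (intro tendsto_unique[OF trivial_limit_at_right_real]) (auto simp: continuous_within)
  then have "AE x in P. x \<in> {..hi}"
    by (subst prob_eq_1[symmetric]) (auto simp: cdf_def2)
  ultimately show ?thesis by eventually_elim auto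
qed

section \<open>The Good--Turing estimator\<close>

text \<open>Exchanging the sums, a symbol seen \<open>m\<close> times contributes
  \<open>m / n\<close> as long as \<open>m \<le> k + 1\<close>. The cutoff is \<open>Suc k\<close>
  because the estimator at \<open>j\<close> counts symbols seen \<open>j + 1\<close> times.\<close>

lemma mass_cdf_good_turing:
  assumes "finite (A n)"
  shows "mass_cdf (good_turing A X n \<omega>) k =
    (\<Sum>a\<in>A n. real (if occurrences X n \<omega> a \<le> Suc k then occurrences X n \<omega> a else 0)) / real n"
proof -
  let ?N = "occurrences X n \<omega>"
  have inner: "(\<Sum>j\<le>k. real (j + 1) * of_bool (?N a = j + 1)) = real (if ?N a \<le> Suc k then ?N a else 0)" for a
  proof (cases "?N a")
    case (Suc m)
    have "(\<Sum>j\<le>k. real (j + 1) * of_bool (?N a = j + 1)) = (\<Sum>j\<le>k. if j = m then real (m + 1) else 0)"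
      by (intro sum.cong) (auto simp: Suc)
    then show ?thesis by (simp add: Suc)
  qed simp
  have "mass_cdf (good_turing A X n \<omega>) k =
      (\<Sum>j\<le>k. \<Sum>a\<in>A n. real (j + 1) * of_bool (?N a = j + 1)) / real n"
    using assms unfolding mass_cdf_def good_turing_def symbols_with_count_def
    by (simp add: sum_divide_distrib sum_of_bool_eq Int_def flip: sum_distrib_left)
  also have "\<dots> = (\<Sum>a\<in>A n. \<Sum>j\<le>k. real (j + 1) * of_bool (?N a = j + 1)) / real n"
    by (subst sum.swap) (rule refl)
  finally show ?thesis by (simp only: inner)
qed

text \<open>Distinct symbols occupy disjoint sets of positions. Equality can fail, since at a given
  \<open>\<omega>\<close> samples may lie outside \<open>B\<close>.\<close>

lemma sum_occurrences_le:
  assumes "finite B"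
  shows "(\<Sum>a\<in>B. occurrences X n \<omega> a) \<le> n"
proof -
  have "(\<Sum>a\<in>B. occurrences X n \<omega> a) = card (\<Union>a\<in>B. {i \<in> {1..n}. X n i \<omega> = a})"
    unfolding occurrences_def using assms by (subst card_UN_disjoint) auto
  also have "\<dots> \<le> card {1..n}"
    by (intro card_mono) auto
  finally show ?thesis by simp
qed

lemma good_turing_nonneg: "good_turing A X n \<omega> k \<ge> 0"
  by (simp add: good_turing_def)

lemma mass_cdf_good_turing_nonneg: "mass_cdf (good_turing A X n \<omega>) k \<ge> 0"
  by (simp add: mass_cdf_def sum_nonneg good_turing_nonneg)

lemma mass_cdf_good_turing_mono:
  "k \<le> l \<Longrightarrow> mass_cdf (good_turing A X n \<omega>) k \<le> mass_cdf (good_turing A X n \<omega>) l"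
  unfolding mass_cdf_def by (intro sum_mono2) (auto simp: good_turing_nonneg)

lemma mass_cdf_good_turing_le_1:
  assumes "finite (A n)"
  shows "mass_cdf (good_turing A X n \<omega>) k \<le> 1"
proof -
  have "(\<Sum>a\<in>A n. real (if occurrences X n \<omega> a \<le> Suc k then occurrences X n \<omega> a else 0))
      \<le> real (\<Sum>a\<in>A n. occurrences X n \<omega> a)"
    unfolding of_nat_sum by (intro sum_mono) auto
  also have "\<dots> \<le> real n"
    by (intro of_nat_mono sum_occurrences_le assms)
  finally show ?thesis
    unfolding mass_cdf_good_turing[of A n, OF assms] by (auto simp: divide_le_eq_1)
qed

text \<open>
  With the coordinate array in place of \<open>X\<close>, statistics of the sample become functions on the
  product space of all samples.
\<close>

abbreviation coordinates :: "nat \<Rightarrow> nat \<Rightarrow> (nat \<Rightarrow> 'a) \<Rightarrow> 'a" where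
  "coordinates \<equiv> \<lambda>_ i x. x i"

lemma occurrences_fun_upd:
  fixes x :: "nat \<Rightarrow> 'a"
  shows "occurrences coordinates n (x(i := y)) a \<le> Suc (occurrences coordinates n x a)"
    and "a \<noteq> x i \<Longrightarrow> a \<noteq> y \<Longrightarrow> occurrences coordinates n (x(i := y)) a = occurrences coordinates n x a"
proof -
  have "card {j \<in> {1..n}. (x(i := y)) j = a} \<le> card (insert i {j \<in> {1..n}. x j = a})"
    by (intro card_mono) auto
  also have "\<dots> \<le> Suc (card {j \<in> {1..n}. x j = a})"
    by (rule card_insert_le_m1) auto
  finally show "occurrences coordinates n (x(i := y)) a \<le> Suc (occurrences coordinates n x a)"
    by (simp add: occurrences_def)
  assume "a \<noteq> x i" "a \<noteq> y"
  then have "{j \<in> {1..n}. (x(i := y)) j = a} = {j \<in> {1..n}. x j = a}" by auto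
  then show "occurrences coordinates n (x(i := y)) a = occurrences coordinates n x a"
    by (simp add: occurrences_def)
qed

text \<open>Only the counts of the old and the new symbol can change, and each truncated count stays
  between 0 and \<open>k + 1\<close>.\<close>

lemma mass_cdf_good_turing_diff:
  fixes x :: "nat \<Rightarrow> 'a"
  assumes "finite (A n)"
  shows "\<bar>mass_cdf (good_turing A coordinates n (x(i := y))) k - mass_cdf (good_turing A coordinates n x) k\<bar>
    \<le> 2 * real (Suc k) / real n"
proof -
  define h where "h x a = real (let m = occurrences coordinates n x a in if m \<le> Suc k then m else 0)"
    for x :: "nat \<Rightarrow> 'a" and a
  have "\<bar>h (x(i := y)) a - h x a\<bar> \<le> real (Suc k) * of_bool (a \<in> {x i, y})" for a
    using occurrences_fun_upd(2)[of a x i y n] by (auto simp: h_def Let_def)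
  then have "\<bar>(\<Sum>a\<in>A n. h (x(i := y)) a) - (\<Sum>a\<in>A n. h x a)\<bar>
      \<le> (\<Sum>a\<in>A n. real (Suc k) * of_bool (a \<in> {x i, y}))"
    unfolding sum_subtractf[symmetric] by (intro order_trans[OF sum_abs] sum_mono)
  also have "\<dots> = real (Suc k) * card (A n \<inter> {x i, y})"
    using assms by (simp only: sum_of_bool_eq Collect_mem_eq flip: sum_distrib_left)
  also have "card (A n \<inter> {x i, y}) \<le> card {x i, y}"
    by (intro card_mono) auto
  also have "card {x i, y} \<le> 2"
    by (simp add: card_insert_if)
  finally have "\<bar>(\<Sum>a\<in>A n. h (x(i := y)) a) - (\<Sum>a\<in>A n. h x a)\<bar> \<le> 2 * real (Suc k)"
    by (simp add: mult.commute)
  then show ?thesis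
    by (simp add: mass_cdf_good_turing[of A n, OF assms] h_def Let_def divide_right_mono
        flip: diff_divide_distrib)
qed

section \<open>Expectation and concentration of the estimated distribution function\<close>

lemma map_pmf_occurrences:
  "map_pmf (\<lambda>x. occurrences coordinates n x a) (Pi_pmf {1..n} d (\<lambda>_. q)) = binomial_pmf n (pmf q a)"
proof -
  have bern: "map_pmf (\<lambda>b. b = a) q = bernoulli_pmf (pmf q a)"
  proof (rule pmf_eqI)
    fix b
    have "measure_pmf.prob q {x. x = a} = pmf q a"
      by (simp add: measure_pmf_single)
    moreover have "measure_pmf.prob q {x. x \<noteq> a} = 1 - pmf q a"
      using measure_pmf.prob_compl[of "{a}" q] by (simp add: measure_pmf_single Compl_eq_Diff_UNIV[symmetric] Compl_eq)
    ultimately show "pmf (map_pmf (\<lambda>b. b = a) q) b = pmf (bernoulli_pmf (pmf q a)) b"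
      by (cases b) (simp_all add: pmf_map vimage_def pmf_le_1)
  qed
  \<comment> \<open>The default \<open>d = a\<close> is the image of \<open>d\<close> under the
    indicator map, as \<open>Pi_pmf_map\<close> requires.\<close>
  have "binomial_pmf n (pmf q a) = map_pmf (\<lambda>f. card {i \<in> {1..n}. f i})
      (Pi_pmf {1..n} (d = a) (\<lambda>_. map_pmf (\<lambda>b. b = a) q))"
    unfolding bern by (rule binomial_pmf_altdef') (auto simp: pmf_le_1)
  also have "\<dots> = map_pmf (\<lambda>x. card {i \<in> {1..n}. x i = a}) (Pi_pmf {1..n} d (\<lambda>_. q))"
    by (subst Pi_pmf_map[where dflt = d]) (simp_all add: pmf.map_comp o_def)
  finally show ?thesis
    by (simp add: occurrences_def)
qed

text \<open>Size biasing: the absorption identity for binomial coefficients trades the factor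
  \<open>j + 1\<close> for one trial. This is where the \<open>n - 1\<close> trials come
  from.\<close>

lemma expectation_truncated_binomial:
  assumes "0 \<le> q" "q \<le> 1"
  shows "measure_pmf.expectation (binomial_pmf (Suc n) q) (\<lambda>m. real (if m \<le> Suc k then m else 0))
    = real (Suc n) * q * binomial_cdf n q k"
proof -
  have shift: "real (Suc j) * (real (Suc n choose Suc j) * q ^ Suc j * (1 - q) ^ (Suc n - Suc j))
      = real (Suc n) * q * Bernstein n j q" for j
  proof -
    have "real (Suc j) * real (Suc n choose Suc j) = real (Suc n) * real (n choose j)"
      by (metis Suc_times_binomial of_nat_mult)
    then show ?thesis
      by (simp add: Bernstein_def mult_ac del: of_nat_Suc binomial_Suc_Suc)
  qed
  have "measure_pmf.expectation (binomial_pmf (Suc n) q) (\<lambda>m. real (if m \<le> Suc k then m else 0))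
     = (\<Sum>m\<le>Suc n. (real (Suc n choose m) * q ^ m * (1 - q) ^ (Suc n - m)) * real (if m \<le> Suc k then m else 0))"
    using assms by (subst expectation_binomial_pmf') simp_all
  also have "\<dots> = (\<Sum>j\<le>n. (real (Suc n choose Suc j) * q ^ Suc j * (1 - q) ^ (Suc n - Suc j)) *
      real (if Suc j \<le> Suc k then Suc j else 0))"
    unfolding sum.atMost_Suc_shift by simp
  also have "\<dots> = (\<Sum>j\<le>n. if j \<le> k then real (Suc n) * q * Bernstein n j q else 0)"
    unfolding shift[symmetric]
    by (intro sum.cong refl) (simp add: mult.commute del: of_nat_Suc binomial_Suc_Suc power_Suc)
  \<comment> \<open>The ranges up to \<open>n\<close> and up to \<open>k\<close> may be exchanged
    because \<open>Bernstein n j q\<close> vanishes for \<open>j > n\<close>.\<close>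
  also have "\<dots> = (\<Sum>j\<le>k. real (Suc n) * q * Bernstein n j q)"
    by (intro sum.mono_neutral_cong) (auto simp: Bernstein_def)
  finally show ?thesis
    by (simp add: binomial_cdf_def sum_distrib_left)
qed

lemma expectation_mass_cdf_good_turing:
  assumes "finite (A n)" "n \<ge> 1"
  shows "measure_pmf.expectation (Pi_pmf {1..n} d (\<lambda>_. q)) (\<lambda>x. mass_cdf (good_turing A coordinates n x) k)
    = (\<Sum>a\<in>A n. pmf q a * binomial_cdf (n - 1) (pmf q a) k)"
proof -
  let ?Q = "Pi_pmf {1..n} d (\<lambda>_. q)"
  let ?h = "\<lambda>m. real (if m \<le> Suc k then m else 0)"
  have int: "integrable ?Q (\<lambda>x. ?h (occurrences coordinates n x a))" for a
    by (intro measure_pmf.integrable_const_bound[where B = "real (Suc k)"]) auto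
  have "measure_pmf.expectation ?Q (\<lambda>x. ?h (occurrences coordinates n x a))
      = real n * (pmf q a * binomial_cdf (n - 1) (pmf q a) k)" for a
  proof -
    have "measure_pmf.expectation ?Q (\<lambda>x. ?h (occurrences coordinates n x a))
        = measure_pmf.expectation (map_pmf (\<lambda>x. occurrences coordinates n x a) ?Q) ?h"
      by simp
    also have "\<dots> = measure_pmf.expectation (binomial_pmf (Suc (n - 1)) (pmf q a)) ?h"
      unfolding map_pmf_occurrences using assms(2) by simp
    also have "\<dots> = real n * (pmf q a * binomial_cdf (n - 1) (pmf q a) k)"
      using assms(2) by (subst expectation_truncated_binomial) (simp_all add: pmf_le_1)
    finally show ?thesis .
  qed
  then show ?thesis
    unfolding mass_cdf_good_turing[of A n, OF assms(1)] using assms(2)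
    by (simp only: integral_divide_zero Bochner_Integration.integral_sum int) (simp flip: sum_distrib_left)
qed

text \<open>McDiarmid's inequality with all differences equal to \<open>2 * (k + 1) / n\<close>,
  whose squares sum to \<open>4 * (k + 1)\<^sup>2 / n\<close>.\<close>

lemma good_turing_concentration:
  fixes d :: 'a and q :: "'a pmf"
  assumes "finite (A n)" "n \<ge> 1" "t \<ge> 0"
  defines "Q \<equiv> Pi_pmf {1..n} d (\<lambda>_. q)"
  shows "measure_pmf.prob Q {x. \<bar>mass_cdf (good_turing A coordinates n x) k -
      measure_pmf.expectation Q (\<lambda>x. mass_cdf (good_turing A coordinates n x) k)\<bar> \<ge> t}
    \<le> 2 * exp (- t\<^sup>2 * real n / (2 * (real (Suc k))\<^sup>2))"
proof -
  let ?c = "\<lambda>_::nat. 2 * real (Suc k) / real n"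
  have S: "(\<Sum>i\<in>{1..n}. (?c i)\<^sup>2) = 4 * (real (Suc k))\<^sup>2 / real n"
    using assms(2) by (simp add: power2_eq_square field_simps)
  have "measure_pmf.prob Q {x. \<bar>mass_cdf (good_turing A coordinates n x) k -
      measure_pmf.expectation Q (\<lambda>x. mass_cdf (good_turing A coordinates n x) k)\<bar> \<ge> t}
    \<le> 2 * exp (- 2 * t\<^sup>2 / (\<Sum>i\<in>{1..n}. (?c i)\<^sup>2))"
    unfolding Q_def
  proof (rule McDiarmid_inequality[where B = 1])
    show "(\<Sum>i\<in>{1..n}. (?c i)\<^sup>2) > 0"
      unfolding S using assms(2) by simp
    show "\<bar>mass_cdf (good_turing A coordinates n x) k\<bar> \<le> 1" for x :: "nat \<Rightarrow> 'a"
      using mass_cdf_good_turing_nonneg[of A coordinates n x k]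
        mass_cdf_good_turing_le_1[of A n coordinates x k] assms(1) by simp
  qed (use assms mass_cdf_good_turing_diff in auto)
  then show ?thesis
    unfolding S using assms(2) by (simp add: field_simps)
qed

section \<open>Rare-events sources\<close>

context rare_events_source
begin

lemma pmf_bounds:
  assumes "n \<ge> 1" "a \<in> A n"
  shows "real n * pmf (p n) a \<in> {lo..hi}"
  using pmf_lower[OF assms] pmf_upper[OF assms] assms(1) by (simp add: field_simps)

lemma real_distribution_shadow: "real_distribution (shadow_distribution p n)"
  unfolding shadow_distribution_def 
  by (intro prob_space.real_distribution_distr measure_pmf.prob_space_axioms) simp

lemma shadow_support:
  assumes "n \<ge> 1"
  shows "AE x in shadow_distribution p n. x \<in> {lo..hi}"
  unfolding shadow_distribution_def
  using assms pmf_on_alphabet pmf_bounds by (subst AE_distr_iff) (auto simp: AE_measure_pmf_iff)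

lemma limit_support: "AE x in P. x \<in> {lo..hi}"
proof (rule weak_limit_support[OF shadow_weak_conv limit_distribution])
  show "\<forall>\<^sub>F n in sequentially. real_distribution (shadow_distribution p n) \<and>
      (AE x in shadow_distribution p n. x \<in> {lo..hi})"
    using eventually_ge_at_top[of 1]
    by eventually_elim (use real_distribution_shadow shadow_support in blast)
qed

sublocale limit: real_distribution P
  by (rule limit_distribution)

lemma hi_pos: "hi > 0"
  using lo_pos lo_le_hi by simp

lemma sum_pmf_alphabet: "n \<ge> 1 \<Longrightarrow> (\<Sum>a\<in>A n. pmf (p n) a) = 1"
  using finite_alphabet pmf_on_alphabet by (intro sum_pmf_eq_1) auto

lemma integral_shadow:
  assumes "n \<ge> 1" "f \<in> borel_measurable borel"
  shows "(LINT x|shadow_distribution p n. f x) = (\<Sum>a\<in>A n. pmf (p n) a * f (real n * pmf (p n) a))"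
proof -
  have "(LINT x|shadow_distribution p n. f x) = (LINT a|p n. f (real n * pmf (p n) a))"
    unfolding shadow_distribution_def using assms(2) by (intro integral_distr) auto
  also have "\<dots> = (\<Sum>a\<in>A n. pmf (p n) a * f (real n * pmf (p n) a))"
    using assms(1) finite_alphabet pmf_on_alphabet
    by (subst integral_measure_pmf[where A = "A n"]) auto
  finally show ?thesis .
qed

abbreviation limit_cdf :: "nat \<Rightarrow> real" where
  "limit_cdf \<equiv> mass_cdf (poisson_mixture {lo..hi} P)"

lemma AE_nonneg: "AE x in P. x \<ge> 0"
  using limit_support by eventually_elim (use lo_pos in auto)

lemma integrable_poisson_density: "integrable P (poisson_density k)"
  using AE_nonneg by (intro limit.integrable_const_bound[where B = 1])
    (auto simp: poisson_density_nonneg poisson_density_le_1)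

lemma integrable_poisson_cdf: "integrable P (poisson_cdf k)"
  unfolding poisson_cdf_def[abs_def] by (intro Bochner_Integration.integrable_sum integrable_poisson_density)

lemma limit_cdf_eq: "limit_cdf k = (LINT x|P. poisson_cdf k x)"
proof -
  have "poisson_mixture {lo..hi} P j = (LINT x|P. poisson_density j x)" for j
  proof -
    have "AE x in P. indicat_real {lo..hi} x *\<^sub>R (x ^ j * exp (- x) / fact j) = poisson_density j x"
      using limit_support by eventually_elim (simp add: poisson_density_def)
    then show ?thesis
      unfolding poisson_mixture_def set_lebesgue_integral_def
      by (intro integral_cong_AE) auto
  qed
  then show ?thesis
    by (simp add: mass_cdf_def poisson_cdf_def[abs_def] Bochner_Integration.integral_sum integrable_poisson_density)
qed

lemma limit_cdf_nonneg: "limit_cdf k \<ge> 0"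
  unfolding limit_cdf_eq using AE_nonneg
  by (intro integral_nonneg_AE) (auto simp: poisson_cdf_nonneg)

lemma limit_cdf_le_1: "limit_cdf k \<le> 1"
  unfolding limit_cdf_eq using AE_nonneg
  by (intro limit.integral_le_const integrable_poisson_cdf) (auto simp: poisson_cdf_le_1)

lemma limit_cdf_mono: "k \<le> l \<Longrightarrow> limit_cdf k \<le> limit_cdf l"
  unfolding limit_cdf_eq using AE_nonneg
  by (intro integral_mono_AE integrable_poisson_cdf) (auto simp: poisson_cdf_mono)

text \<open>The Chernoff bound worsens as the mean grows, so the worst mean in the support is
  \<open>hi\<close>.\<close>

lemma limit_cdf_ge: "limit_cdf k \<ge> 1 - exp (- real k) * exp ((exp 1 - 1) * hi)"
  unfolding limit_cdf_eq
proof (intro limit.integral_ge_const integrable_poisson_cdf)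
  show "AE x in P. 1 - exp (- real k) * exp ((exp 1 - 1) * hi) \<le> poisson_cdf k x"
    using limit_support
  proof eventually_elim
    case (elim x)
    then have "exp (- real k) * exp ((exp 1 - 1) * x) \<le> exp (- real k) * exp ((exp 1 - 1) * hi)"
      by (intro mult_left_mono) auto
    moreover have "x \<ge> 0"
      using elim lo_pos by simp
    ultimately show ?case
      using poisson_cdf_ge[of x k] by linarith
  qed
qed

text \<open>By \<open>expectation_mass_cdf_good_turing\<close> this is the mean of the estimated
  distribution function. As an explicit sum it makes sense for the source alone, without
  samples.\<close>

definition expected_cdf :: "nat \<Rightarrow> nat \<Rightarrow> real" where
  "expected_cdf n k = (\<Sum>a\<in>A n. pmf (p n) a * binomial_cdf (n - 1) (pmf (p n) a) k)"

lemma expected_cdf_bias: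
  assumes n: "n \<ge> 1"
  shows "\<bar>limit_cdf k - expected_cdf n k\<bar> \<le> wasserstein (shadow_distribution p n) P + (hi\<^sup>2 + hi) / real n"
proof -
  let ?S = "LINT x|shadow_distribution p n. poisson_cdf k x"
  have "\<bar>?S - limit_cdf k\<bar> \<le> wasserstein (shadow_distribution p n) P"
    unfolding limit_cdf_eq
    using lo_pos DERIV_poisson_cdf
    by (intro integral_diff_le_wasserstein[where g = "\<lambda>x. - poisson_density k x" and lo = lo and hi = hi]
          real_distribution_shadow shadow_support n limit_support limit_distribution
          continuous_on_minus continuous_on_poisson_density)
       (auto simp: poisson_density_nonneg poisson_density_le_1)
  moreover have "\<bar>expected_cdf n k - ?S\<bar> \<le> (hi\<^sup>2 + hi) / real n"
  proof -
    have pointwise: "\<bar>binomial_cdf (n - 1) (pmf (p n) a) k - poisson_cdf k (real n * pmf (p n) a)\<bar>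
        \<le> (hi\<^sup>2 + hi) / real n" if a: "a \<in> A n" for a
    proof -
      define q where "q = pmf (p n) a"
      have q: "0 \<le> q" "q \<le> 1" "real n * q \<le> hi"
        using pmf_bounds[OF n a] by (auto simp: q_def pmf_le_1)
      have "\<bar>binomial_cdf (n - 1) q k - poisson_cdf k (real (n - 1) * q)\<bar> \<le> real (n - 1) * q\<^sup>2"
        using q by (intro binomial_cdf_poisson_cdf)
      also have "\<dots> \<le> real n * q\<^sup>2"
        by (intro mult_right_mono) auto
      also have "\<dots> = (real n * q)\<^sup>2 / real n"
        using n by (simp add: power2_eq_square)
      also have "\<dots> \<le> hi\<^sup>2 / real n"
        using q by (intro divide_right_mono power_mono) auto
      finally have "\<bar>binomial_cdf (n - 1) q k - poisson_cdf k (real (n - 1) * q)\<bar> \<le> hi\<^sup>2 / real n" .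
      \<comment> \<open>Passing from \<open>n - 1\<close> to \<open>n\<close> trials moves the
        Poisson mean by \<open>q\<close>, which is at most \<open>hi / n\<close>.\<close>
      moreover have "\<bar>poisson_cdf k (real (n - 1) * q) - poisson_cdf k (real n * q)\<bar> \<le> hi / real n"
      proof -
        have "\<bar>poisson_cdf k (real (n - 1) * q) - poisson_cdf k (real n * q)\<bar>
            \<le> \<bar>real (n - 1) * q - real n * q\<bar>"
          using q by (intro poisson_cdf_lipschitz) auto
        also have "\<dots> = q"
          using n q by (simp add: of_nat_diff algebra_simps)
        also have "\<dots> \<le> hi / real n"
          using n q by (simp add: field_simps)
        finally show ?thesis .
      qed
      ultimately show ?thesis
        unfolding q_def[symmetric] add_divide_distrib by linarith
    qed
    have "\<bar>expected_cdf n k - ?S\<bar> = \<bar>\<Sum>a\<in>A n. pmf (p n) a *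
        (binomial_cdf (n - 1) (pmf (p n) a) k - poisson_cdf k (real n * pmf (p n) a))\<bar>"
      by (simp add: expected_cdf_def integral_shadow[OF n] sum_subtractf right_diff_distrib)
    also have "\<dots> \<le> (\<Sum>a\<in>A n. pmf (p n) a * ((hi\<^sup>2 + hi) / real n))"
      by (intro order_trans[OF sum_abs] sum_mono)
        (simp only: abs_mult abs_of_nonneg[OF pmf_nonneg] mult_left_mono pointwise pmf_nonneg)
    also have "\<dots> = (hi\<^sup>2 + hi) / real n"
      by (simp only: sum_pmf_alphabet[OF n] mult_1 flip: sum_distrib_right)
    finally show ?thesis .
  qed
  ultimately show ?thesis by linarith
qed

end

lemma good_turing_cong:
  "(\<And>i. i \<in> {1..n} \<Longrightarrow> X n i \<omega> = Y n i \<omega>') \<Longrightarrow> good_turing A X n \<omega> k = good_turing A Y n \<omega>' k"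
  unfolding good_turing_def symbols_with_count_def occurrences_def
  by (simp cong: conj_cong)

text \<open>Beyond \<open>K\<close> both functions are at most 1, while by monotonicity
  \<open>F\<close> stays above \<open>1 - e'\<close> and \<open>G\<close> above
  \<open>1 - e' - e\<close>.\<close>

lemma SUP_abs_cdf_diff_le:
  fixes F G :: "nat \<Rightarrow> real"
  assumes F: "mono F" "\<And>k. F k \<le> 1" and G: "mono G" "\<And>k. G k \<le> 1"
    and close: "\<And>k. k \<le> K \<Longrightarrow> \<bar>F k - G k\<bar> \<le> e" and tail: "F K \<ge> 1 - e'"
  shows "(SUP k. \<bar>F k - G k\<bar>) \<le> e + e'"
proof (rule cSUP_least)
  fix k
  have "e' \<ge> 0" "e \<ge> 0"
    using F(2)[of K] tail close[of K] by auto
  show "\<bar>F k - G k\<bar> \<le> e + e'"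
  proof (cases "k \<le> K")
    case True
    then show ?thesis using close[of k] \<open>e' \<ge> 0\<close> by linarith
  next
    case False
    then have "F K \<le> F k" "G K \<le> G k"
      using F(1) G(1) by (auto intro: monoD)
    then show ?thesis
      using F(2)[of k] G(2)[of k] close[of K] tail \<open>e \<ge> 0\<close> \<open>e' \<ge> 0\<close> by auto
  qed
qed simp

text \<open>The range has to be bounded above, since a real supremum carries no information
  otherwise.\<close>

lemma SUP_abs_cdf_diff_nonneg:
  fixes F G :: "nat \<Rightarrow> real"
  assumes "\<And>k. F k \<in> {0..1}" "\<And>k. G k \<in> {0..1}"
  shows "(SUP k. \<bar>F k - G k\<bar>) \<ge> 0"
proof -
  have "bdd_above (range (\<lambda>k. \<bar>F k - G k\<bar>))"
  proof (rule bdd_aboveI2)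
    show "\<bar>F k - G k\<bar> \<le> 1" for k
      using assms(1)[of k] assms(2)[of k] by auto
  qed
  then show ?thesis
    by (rule cSUP_upper2[where x = 0]) auto
qed

section \<open>Almost sure deviation bounds for the samples\<close>

context rare_events_sampling
begin

lemma row_measurable: "n \<ge> 1 \<Longrightarrow> i \<in> {1..n} \<Longrightarrow> X n i \<in> measurable M (count_space UNIV)"
  using row_indep by (auto simp: indep_vars_def)

text \<open>Both sides are the product of the same marginals. The restriction reconciles the value
  \<open>d\<close> outside the index set in \<open>Pi_pmf\<close> with the extensional functions of
  \<open>PiM\<close>.\<close>

lemma distr_row:
  assumes n: "n \<ge> 1"
  shows "distr M (PiM {1..n} (\<lambda>_. count_space UNIV)) (\<lambda>\<omega>. \<lambda>i\<in>{1..n}. X n i \<omega>)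
    = distr (Pi_pmf {1..n} d (\<lambda>_. p n)) (PiM {1..n} (\<lambda>_. count_space UNIV)) (\<lambda>x. restrict x {1..n})"
proof -
  let ?Q = "Pi_pmf {1..n} d (\<lambda>_. p n)"
  have ne: "{1..n} \<noteq> {}" using n by auto
  have "distr M (PiM {1..n} (\<lambda>_. count_space UNIV)) (\<lambda>\<omega>. \<lambda>i\<in>{1..n}. X n i \<omega>)
      = PiM {1..n} (\<lambda>i. distr M (count_space UNIV) (X n i))"
    using row_indep[OF n] indep_vars_iff_distr_eq_PiM'[OF ne, where M' = "\<lambda>_. count_space UNIV" and X = "X n"]
      row_measurable[OF n] by simp
  also have "\<dots> = PiM {1..n} (\<lambda>i. distr ?Q (count_space UNIV) (\<lambda>x. x i))"
    using row_distr[OF n] Pi_pmf_component[of "{1..n}" _ d "\<lambda>_. p n"]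
    by (intro PiM_cong refl) (simp flip: map_pmf_rep_eq)
  also have "\<dots> = distr ?Q (PiM {1..n} (\<lambda>_. count_space UNIV)) (\<lambda>x. restrict x {1..n})"
    using prob_space.indep_vars_iff_distr_eq_PiM'[where M = "measure_pmf ?Q",
        OF measure_pmf.prob_space_axioms ne, where M' = "\<lambda>_. count_space UNIV" and X = "\<lambda>i x. x i"]
      indep_vars_Pi_pmf[of "{1..n}" d "\<lambda>_. p n"] by simp
  finally show ?thesis .
qed

lemma prob_good_turing_deviation:
  fixes k :: nat
  assumes n: "n \<ge> 1" and "t \<ge> 0"
  defines "E \<equiv> {\<omega> \<in> space M. \<bar>mass_cdf (good_turing A X n \<omega>) k - expected_cdf n k\<bar> \<ge> t}"
  shows "E \<in> events" and "prob E \<le> 2 * exp (- t\<^sup>2 * real n / (2 * (real (Suc k))\<^sup>2))"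
proof -
  define d :: 'a where "d = undefined"
  let ?Q = "Pi_pmf {1..n} d (\<lambda>_. p n)" and ?S = "PiM {1..n} (\<lambda>_. count_space (UNIV :: 'a set))"
  let ?F = "\<lambda>x. mass_cdf (good_turing A coordinates n x) k"
  let ?X = "\<lambda>\<omega>. \<lambda>i\<in>{1..n}. X n i \<omega>"
  have fin: "finite (A n)" using finite_alphabet n .
  have "(\<lambda>x. occurrences coordinates n x a) \<in> measurable ?S (count_space UNIV)" for a
  proof -
    have "(\<lambda>x. \<Sum>i\<in>{1..n}. of_bool (x i = a) :: nat) \<in> measurable ?S (count_space UNIV)"
      by measurable
    moreover have "occurrences coordinates n x a = (\<Sum>i\<in>{1..n}. of_bool (x i = a))" for x
      by (simp add: occurrences_def sum_of_bool_eq Int_def)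
    ultimately show ?thesis by simp
  qed
  then have F_meas [measurable]: "?F \<in> borel_measurable ?S"
    unfolding mass_cdf_good_turing[of A n, OF fin] by measurable
  define B where "B = {x \<in> space ?S. \<bar>?F x - expected_cdf n k\<bar> \<ge> t}"
  have B: "B \<in> sets ?S" unfolding B_def by measurable
  have X_meas: "?X \<in> measurable M ?S"
    using row_measurable[OF n] by (intro measurable_restrict) auto
  have cdf_X: "mass_cdf (good_turing A X n \<omega>) k = ?F (?X \<omega>)" for \<omega>
    unfolding mass_cdf_def by (intro sum.cong refl good_turing_cong) auto
  have cdf_restrict: "?F (restrict x {1..n}) = ?F x" for x
    unfolding mass_cdf_def by (intro sum.cong refl good_turing_cong) auto
  have E_eq: "E = ?X -` B \<inter> space M"
    by (auto simp: E_def B_def space_PiM cdf_X)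
  show "E \<in> events"
    unfolding E_eq using X_meas B by (rule measurable_sets)
  have "prob E = measure (distr M ?S ?X) B"
    unfolding E_eq using X_meas B by (rule measure_distr[symmetric])
  also have "\<dots> = measure_pmf.prob ?Q ((\<lambda>x. restrict x {1..n}) -` B)"
    unfolding distr_row[OF n, of d] using B by (subst measure_distr) (auto simp: space_PiM)
  also have "(\<lambda>x. restrict x {1..n}) -` B = {x. \<bar>?F x - measure_pmf.expectation ?Q ?F\<bar> \<ge> t}"
    unfolding expectation_mass_cdf_good_turing[of A n, OF fin n]
    by (auto simp: B_def space_PiM cdf_restrict expected_cdf_def simp del: One_nat_def)
  also have "measure_pmf.prob ?Q \<dots> \<le> 2 * exp (- t\<^sup>2 * real n / (2 * (real (Suc k))\<^sup>2))"
    by (rule good_turing_concentration[of A n, OF fin n \<open>t \<ge> 0\<close>])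
  finally show "prob E \<le> 2 * exp (- t\<^sup>2 * real n / (2 * (real (Suc k))\<^sup>2))" .
qed

text \<open>A union bound over the logarithmically many \<open>k\<close>, followed by the first
  Borel-Cantelli lemma, which needs no independence between rows.\<close>

lemma AE_eventually_deviation_less:
  assumes "\<delta> > 0"
  shows "AE \<omega> in M. \<forall>\<^sub>F n in sequentially. \<forall>k\<le>nat \<lceil>ln (real n)\<rceil>.
    \<bar>mass_cdf (good_turing A X n \<omega>) k - expected_cdf n k\<bar> < real n powr (\<delta> / 2 - 1 / 2)"
proof -
  define K where "K n = nat \<lceil>ln (real n)\<rceil>" for n
  define t where "t n = real n powr (\<delta> / 2 - 1 / 2)" for n
  define E where "E n k = {\<omega> \<in> space M. \<bar>mass_cdf (good_turing A X n \<omega>) k - expected_cdf n k\<bar> \<ge> t n}" for n k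
  define bad where "bad n = (\<Union>k\<le>K n. E n k)" for n
  \<comment> \<open>\<open>ln n + 2\<close> bounds both the number of admissible \<open>k\<close>
    and each \<open>k + 1\<close>. The power \<open>n powr \<delta>\<close> in the exponent beats
    all logarithms, so \<open>b\<close> is summable.\<close>
  define b where "b n = 2 * (ln (real n) + 2) * exp (- (real n powr \<delta>) / (2 * (ln (real n) + 2)\<^sup>2))" for n
  have E: "E n k \<in> events" "prob (E n k) \<le> 2 * exp (- (real n powr \<delta>) / (2 * (real (Suc k))\<^sup>2))"
    if n: "n \<ge> 1" for n k
  proof -
    have "t n \<ge> 0" by (simp add: t_def)
    note dev = prob_good_turing_deviation[OF n this, of k]
    have "(t n)\<^sup>2 * real n = real n powr \<delta>"
      using n by (simp add: t_def power2_eq_square flip: powr_add) (simp add: powr_diff)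
    then show "E n k \<in> events" "prob (E n k) \<le> 2 * exp (- (real n powr \<delta>) / (2 * (real (Suc k))\<^sup>2))"
      using dev by (simp_all add: E_def)
  qed
  have prob_bad: "prob (bad n) \<le> b n" if n: "n \<ge> 1" for n
  proof -
    have K: "real (Suc (K n)) \<le> ln (real n) + 2"
      using n by (simp add: K_def) linarith
    have "prob (bad n) \<le> (\<Sum>k\<le>K n. prob (E n k))"
      unfolding bad_def using E(1)[OF n] by (intro measure_UNION_le) auto
    also have "\<dots> \<le> (\<Sum>k\<le>K n. 2 * exp (- (real n powr \<delta>) / (2 * (ln (real n) + 2)\<^sup>2)))"
    proof (rule sum_mono)
      fix k assume "k \<in> {..K n}"
      then have "real (Suc k) \<le> ln (real n) + 2"
        using K by simp
      then have "real n powr \<delta> / (2 * (ln (real n) + 2)\<^sup>2) \<le> real n powr \<delta> / (2 * (real (Suc k))\<^sup>2)"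
        by (intro divide_left_mono mult_left_mono power_mono mult_pos_pos zero_less_power) auto
      then show "prob (E n k) \<le> 2 * exp (- (real n powr \<delta>) / (2 * (ln (real n) + 2)\<^sup>2))"
        by (intro order_trans[OF E(2)[OF n]]) simp
    qed
    also have "\<dots> = real (Suc (K n)) * (2 * exp (- (real n powr \<delta>) / (2 * (ln (real n) + 2)\<^sup>2)))"
      by simp
    also have "\<dots> \<le> (ln (real n) + 2) * (2 * exp (- (real n powr \<delta>) / (2 * (ln (real n) + 2)\<^sup>2)))"
      by (rule mult_right_mono[OF K]) simp
    also have "\<dots> = b n"
      by (simp only: b_def mult_ac)
    finally show ?thesis .
  qed
  have b_bigo: "b \<in> O(\<lambda>n. 1 / real n ^ 2)"
    unfolding b_def using assms by real_asymp
  have "summable (\<lambda>n. norm (1 / real n ^ 2))"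
    using inverse_power_summable[of 2, where 'a = real] by (simp add: divide_inverse)
  then have "summable b"
    using b_bigo by (rule summable_comparison_test_bigo)
  \<comment> \<open>The shift removes index \<open>0\<close>, for which \<open>prob_bad\<close> says
    nothing.\<close>
  then have "summable (\<lambda>n. b (Suc n))"
    by (subst summable_Suc_iff)
  then have "summable (\<lambda>n. prob (bad (Suc n)))"
    by (rule summable_comparison_test'[where N = 0]) (simp add: prob_bad)
  then have "AE \<omega> in M. \<forall>\<^sub>F n in sequentially. \<omega> \<in> space M - bad (Suc n)"
    using E(1) unfolding bad_def by (intro borel_cantelli_AE1) (auto simp: emeasure_eq_measure)
  then show ?thesis
  proof eventually_elim
    case (elim \<omega>)
    then have "\<forall>\<^sub>F n in sequentially. \<omega> \<in> space M - bad n"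
      by (subst (asm) eventually_sequentially_Suc)
    then show ?case
      by eventually_elim (auto simp: bad_def E_def t_def K_def not_le)
  qed
qed

lemma SUP_deviation_le:
  assumes n: "n \<ge> 1"
    and dev: "\<And>k. k \<le> nat \<lceil>ln (real n)\<rceil> \<Longrightarrow> \<bar>mass_cdf (good_turing A X n \<omega>) k - expected_cdf n k\<bar> \<le> t"
  shows "(SUP k. \<bar>limit_cdf k - mass_cdf (good_turing A X n \<omega>) k\<bar>)
    \<le> t + wasserstein (shadow_distribution p n) P + (hi\<^sup>2 + hi + exp ((exp 1 - 1) * hi)) / real n"
proof -
  let ?K = "nat \<lceil>ln (real n)\<rceil>"
  have "(SUP k. \<bar>limit_cdf k - mass_cdf (good_turing A X n \<omega>) k\<bar>)
    \<le> (t + wasserstein (shadow_distribution p n) P + (hi\<^sup>2 + hi) / real n) + exp ((exp 1 - 1) * hi) / real n"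
  proof (rule SUP_abs_cdf_diff_le)
    show "\<bar>limit_cdf k - mass_cdf (good_turing A X n \<omega>) k\<bar>
        \<le> t + wasserstein (shadow_distribution p n) P + (hi\<^sup>2 + hi) / real n" if "k \<le> ?K" for k
      using dev[OF that] expected_cdf_bias[OF n, of k] by linarith
    \<comment> \<open>The cutoff is chosen for this: \<open>?K \<ge> ln n\<close> makes the Poisson
      tail at most a constant times \<open>1 / n\<close>.\<close>
    have "exp (- real ?K) \<le> exp (- ln (real n))"
      by simp linarith
    also have "\<dots> = 1 / real n"
      using n by (simp add: exp_minus divide_inverse)
    finally have "exp (- real ?K) * exp ((exp 1 - 1) * hi) \<le> 1 / real n * exp ((exp 1 - 1) * hi)"
      by (rule mult_right_mono) simp
    then show "limit_cdf ?K \<ge> 1 - exp ((exp 1 - 1) * hi) / real n"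
      using limit_cdf_ge[of ?K] by simp
  qed (use n finite_alphabet in \<open>auto intro!: monoI limit_cdf_mono limit_cdf_le_1
        mass_cdf_good_turing_mono mass_cdf_good_turing_le_1\<close>)
  then show ?thesis
    by (simp add: add_divide_distrib)
qed

end

section \<open>Assembling the convergence rate\<close>

theorem theorem2:
  fixes A :: "nat \<Rightarrow> 'a set" and p :: "nat \<Rightarrow> 'a pmf" and lo hi :: real and P :: "real measure"
    and M :: "'w measure" and X :: "nat \<Rightarrow> nat \<Rightarrow> 'w \<Rightarrow> 'a" and r \<delta> :: real
  assumes "rare_events_sampling A p lo hi P M X"
    and "r > 0"
    and "(\<lambda>n. real n powr r * wasserstein (shadow_distribution p n) P) \<longlonglongrightarrow> 0"
    and "\<delta> > 0"
  shows "AE \<omega> in M. (\<lambda>n. real n powr (min r (1 / 2) - \<delta>) *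
      (SUP k. \<bar>mass_cdf (poisson_mixture {lo..hi} P) k - mass_cdf (good_turing A X n \<omega>) k\<bar>))
    \<longlonglongrightarrow> 0"
proof -
  interpret rare_events_sampling A p lo hi P M X by fact
  define s where "s = min r (1 / 2) - \<delta>"
  define D where "D = hi\<^sup>2 + hi + exp ((exp 1 - 1) * hi)"
  define W where "W n = wasserstein (shadow_distribution p n) P" for n
  have D: "D \<ge> 0" using hi_pos by (simp add: D_def)
  \<comment> \<open>A deterministic null sequence dominating the rescaled error. Half of
    \<open>\<delta>\<close> was spent on the deviation threshold and the other half remains in the
    first term; \<open>s \<le> r\<close> handles the second and \<open>s \<le> 1 / 2\<close> the
    third.\<close>
  define v where "v n = real n powr (- (\<delta> / 2)) + real n powr r * W n + D * real n powr (- (1 / 2))" for n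
  have "(\<lambda>n. real n powr (- (\<delta> / 2))) \<longlonglongrightarrow> 0" "(\<lambda>n. D * real n powr (- (1 / 2))) \<longlonglongrightarrow> 0"
    using \<open>\<delta> > 0\<close> by real_asymp+
  then have v: "v \<longlonglongrightarrow> 0 + 0 + 0"
    unfolding v_def W_def using assms(3) by (intro tendsto_add)
  have v_ge: "real n powr s * (real n powr (\<delta> / 2 - 1 / 2) + W n + D / real n) \<le> v n" if n: "n \<ge> 1" for n
  proof -
    have "real n powr s * real n powr (\<delta> / 2 - 1 / 2) \<le> real n powr (- (\<delta> / 2))"
      using n by (simp add: s_def flip: powr_add) (intro powr_mono, auto)
    moreover have "real n powr s * W n \<le> real n powr r * W n"
      using n \<open>\<delta> > 0\<close> wasserstein_nonneg
      by (intro mult_right_mono powr_mono) (auto simp: s_def W_def)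
    moreover have "real n powr s * (D / real n) \<le> D * real n powr (- (1 / 2))"
    proof -
      have "real n powr s / real n = real n powr (s - 1)"
        using n by (simp add: powr_diff)
      also have "\<dots> \<le> real n powr (- (1 / 2))"
        using n \<open>\<delta> > 0\<close> by (intro powr_mono) (auto simp: s_def)
      finally have "D * (real n powr s / real n) \<le> D * real n powr (- (1 / 2))"
        using D by (rule mult_left_mono)
      then show ?thesis
        by (simp add: mult.commute)
    qed
    ultimately show ?thesis
      by (simp add: v_def distrib_left)
  qed
  have SUP_nonneg: "(SUP k. \<bar>limit_cdf k - mass_cdf (good_turing A X n \<omega>) k\<bar>) \<ge> 0" if "n \<ge> 1" for n \<omega>
    using that finite_alphabet
    by (intro SUP_abs_cdf_diff_nonneg)
      (auto simp: limit_cdf_nonneg limit_cdf_le_1 mass_cdf_good_turing_nonneg mass_cdf_good_turing_le_1)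
  show ?thesis
    using AE_eventually_deviation_less[OF \<open>\<delta> > 0\<close>]
  proof eventually_elim
    case (elim \<omega>)
    let ?S = "\<lambda>n. SUP k. \<bar>limit_cdf k - mass_cdf (good_turing A X n \<omega>) k\<bar>"
    have upper: "\<forall>\<^sub>F n in sequentially. real n powr s * ?S n \<le> v n"
      using elim eventually_ge_at_top[of 1]
    proof eventually_elim
      case (elim n)
      then have "?S n \<le> real n powr (\<delta> / 2 - 1 / 2) + W n + D / real n"
        unfolding W_def D_def by (intro SUP_deviation_le) (auto intro: less_imp_le)
      then show ?case
        by (intro order_trans[OF mult_left_mono v_ge]) (use elim in auto)
    qed
    have lower: "\<forall>\<^sub>F n in sequentially. 0 \<le> real n powr s * ?S n"
      using eventually_ge_at_top[of 1]
      by eventually_elim (intro mult_nonneg_nonneg SUP_nonneg, auto)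
    show "(\<lambda>n. real n powr (min r (1 / 2) - \<delta>) * ?S n) \<longlonglongrightarrow> 0"
      using tendsto_sandwich[OF lower upper tendsto_const] v by (simp add: s_def)
  qed
qed

end
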